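(* Let $k\ge 2$, $n\ge 2$, and $2\le m\le|\mathbf{Neck}_k(n)|$. Let $\alpha_1,\alpha_2,\ldots,\alpha_m$ be the last $m$ strings of $\mathbf{Neck}_k(n)$ when it is listed in lexicographic order. Then $\text{UC}(\alpha_1,\ldots,\alpha_m)=pr(\alpha_1)pr(\alpha_2)\cdots pr(\alpha_m)$ is a universal cycle for $\mathbf{S}=\bigcup_{i=1}^m\mathbf{sub}_n(\alpha_i)$.
   Context: $\Sigma_k=\{0,1,\ldots,k-1\}$ with the natural order; $\Sigma_k^n$ is the set of strings of length $n$ over $\Sigma_k$. A necklace is a string that is lexicographically smallest among all its rotations; $\mathbf{Neck}_k(n)$ is the set of $k$-ary necklaces of length $n$. Lexicographic order on strings of equal length: $a_1\cdots a_n$ precedes $b_1\cdots b_n$ if $a_i<b_i$ at the smallest $i$ with $a_i\ne b_i$. The periodic reduction $pr(a_1\cdots a_n)$ is $a_1\cdots a_p$ where $p$ is the smallest integer with $a_1\cdots a_n=(a_1\cdots a_p)^{n/p}$. For a string $\alpha$, $\mathbf{sub}_n(\alpha)$ is the set of all length-$n$ substrings of $\alpha$ viewed as a cyclic string (windows may wrap around). For a nonempty $\mathbf{S}\subseteq\Sigma_k^n$, a universal cycle for $\mathbf{S}$ is a string of length $|\mathbf{S}|$ which, viewed cyclically, contains every string of $\mathbf{S}$ as a length-$n$ substring exactly once. *)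

theory Defs
  imports "HOL-Library.List_Lexorder"
begin

text \<open>Strings are lists of naturals. The order \<open>\<le>\<close> on them is the library's lexicographic
  order (in which a proper prefix is smaller), used below only on lists of equal length.\<close>

definition strings :: "nat \<Rightarrow> nat \<Rightarrow> nat list set" where
  "strings k n = {w. length w = n \<and> set w \<subseteq> {0..<k}}"

definition necklace :: "nat list \<Rightarrow> bool" where
  "necklace w \<longleftrightarrow> (\<forall>i. w \<le> rotate i w)"

definition Neck :: "nat \<Rightarrow> nat \<Rightarrow> nat list set" where
  "Neck k n = {w \<in> strings k n. necklace w}"

definition pr :: "nat list \<Rightarrow> nat list" where
  "pr w = take (LEAST p. 0 < p \<and> p dvd length w \<and>
                  w = concat (replicate (length w div p) (take p w))) w"

definition cyclic_window :: "nat \<Rightarrow> nat list \<Rightarrow> nat \<Rightarrow> nat list" where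
  "cyclic_window n w i = map (\<lambda>j. w ! ((i + j) mod length w)) [0..<n]"

definition sub :: "nat \<Rightarrow> nat list \<Rightarrow> nat list set" where
  "sub n w = {cyclic_window n w i | i. i < length w}"

definition universal_cycle :: "nat \<Rightarrow> nat \<Rightarrow> nat list set \<Rightarrow> nat list \<Rightarrow> bool" where
  "universal_cycle k n S u \<longleftrightarrow>
     S \<noteq> {} \<and> S \<subseteq> strings k n \<and> length u = card S \<and>
     (\<forall>s\<in>S. \<exists>!i. i < length u \<and> cyclic_window n u i = s)"

definition UC :: "nat list list \<Rightarrow> nat list" where
  "UC \<alpha>s = concat (map pr \<alpha>s)"

lemma finite_strings: "finite (strings k n)"
  unfolding strings_def
  by (rule finite_subset[OF _ finite_lists_length_eq[of "{0..<k}" n]]) auto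

lemma finite_Neck: "finite (Neck k n)"
  unfolding Neck_def using finite_strings by simp

end

theory Submission
  imports Defs
begin

text \<open>Write \<open>M\<close> for the largest letter. Prepend the necklaces one at a time, the smallest last.
  A necklace other than \<open>M\<^sup>n\<close> has the form \<open>\<alpha> = x c M\<^sup>t\<close> with \<open>c < M\<close>. Then \<open>x M\<^sup>t\<^sup>+\<^sup>1\<close> is again a
  necklace, so the lexicographic successor of \<open>\<alpha>\<close> still starts with \<open>x\<close>. The universal cycle \<open>U\<close>
  of the larger necklaces therefore starts with \<open>x\<close> and ends with \<open>M\<^sup>t\<close>, as does \<open>pr \<alpha>\<close> read
  cyclically: the two cycles share the word \<open>M\<^sup>t x\<close> of length \<open>n - 1\<close>, and placing \<open>pr \<alpha>\<close> in front
  of \<open>U\<close> joins them there without losing a window. As the total length equals the number of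
  words to be covered, each word occurs exactly once.\<close>

section \<open>Lexicographic order\<close>

lemma append_le_append_iff:
  fixes u v s t :: "'a :: linorder list"
  assumes "length u = length v"
  shows "u @ s \<le> v @ t \<longleftrightarrow> u < v \<or> u = v \<and> s \<le> t"
  using assms by (induction u v rule: list_induct2) auto

lemma take_eq_between_common_prefix:
  fixes u s t b :: "'a :: linorder list"
  assumes "u @ s \<le> b" "b \<le> u @ t" "length u \<le> length b"
  shows "take (length u) b = u"
proof -
  obtain v r where b: "b = v @ r" "length v = length u"
    using assms(3) by (metis append_take_drop_id length_take min.absorb2)
  have "u \<le> v" "v \<le> u"
    using assms(1,2) b append_le_append_iff[of u v s r] append_le_append_iff[of v u r t] by auto
  then show ?thesis using b by simp
qed

lemma trailing_replicate_decomp: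
  "w \<noteq> replicate (length w) M \<Longrightarrow> \<exists>x c t. w = x @ c # replicate t M \<and> c \<noteq> M"
proof (induction w rule: rev_induct)
  case (snoc a w)
  show ?case
  proof (cases "a = M")
    case True
    then have "w \<noteq> replicate (length w) M"
      using snoc.prems by (metis length_append_singleton replicate_append_same replicate_Suc)
    then obtain x c t where "w = x @ c # replicate t M" "c \<noteq> M" using snoc.IH by blast
    then have "w @ [a] = x @ c # replicate (Suc t) M"
      using True by (simp add: replicate_append_same)
    then show ?thesis using \<open>c \<noteq> M\<close> by blast
  next
    case False
    then show ?thesis by (intro exI[of _ w] exI[of _ a] exI[of _ 0]) simp
  qed
qed simp

section \<open>Necklaces\<close>

text \<open>Writing the alphabet size as \<open>Suc M\<close> gives the largest letter the name
  \<open>M\<close> used throughout.\<close>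

lemma Neck_Suc_iff:
  "w \<in> Neck (Suc M) n \<longleftrightarrow> length w = n \<and> (\<forall>a\<in>set w. a \<le> M) \<and> necklace w"
  by (auto simp: Neck_def strings_def less_Suc_eq_le)

lemma necklaceI:
  assumes "\<And>y z. w = y @ z \<Longrightarrow> y \<noteq> [] \<Longrightarrow> z \<noteq> [] \<Longrightarrow> w \<le> z @ y"
  shows "necklace w"
  unfolding necklace_def
proof
  fix i
  define j where "j = i mod length w"
  have rot: "rotate i w = drop j w @ take j w"
    by (simp add: j_def rotate_drop_take)
  show "w \<le> rotate i w"
  proof (cases "j = 0 \<or> w = []")
    case False
    then have "j < length w" "0 < j" by (auto simp: j_def)
    then show ?thesis using assms[of "take j w" "drop j w"] False rot by simp
  qed (auto simp: rot)
qed

lemma necklaceD: "necklace (y @ z) \<Longrightarrow> y @ z \<le> z @ y"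
  unfolding necklace_def by (metis rotate_append)

lemma replicate_in_Neck: "replicate n M \<in> Neck (Suc M) n"
  by (auto simp: Neck_Suc_iff intro!: necklaceI)
    (metis append_replicate_commute append_eq_conv_conj drop_replicate order_refl take_replicate)

lemma le_replicate:
  fixes w :: "nat list"
  shows "\<forall>a\<in>set w. a \<le> M \<Longrightarrow> w \<le> replicate (length w) M"
  by (induction w) auto

text \<open>A rotation starting inside \<open>x\<close> reads \<open>z'\<close> and then the letter
  in the place of \<open>c\<close>; these face the prefix \<open>u @ [d]\<close> of
  \<open>x\<close>. The old necklace inequality gives \<open>u < z'\<close>, or
  \<open>u = z'\<close> and \<open>d \<le> c\<close>, so raising \<open>c\<close> to
  \<open>M\<close> makes the comparison strict there. A rotation starting in the tail begins with
  \<open>M\<close>, whereas the first letter of \<open>x\<close> is at most \<open>c < M\<close>.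
  For empty \<open>x\<close> the raised word is M^n.\<close>

lemma necklace_raise_tail:
  assumes "x @ c # replicate t M \<in> Neck (Suc M) n" "c < M"
  shows "x @ replicate (Suc t) M \<in> Neck (Suc M) n"
proof (cases x)
  case (Cons a x')
  have neck: "necklace (x @ c # replicate t M)" using assms by (simp add: Neck_Suc_iff)
  have "necklace (x @ replicate (Suc t) M)"
  proof (rule necklaceI)
    fix y z assume yz: "x @ replicate (Suc t) M = y @ z" "y \<noteq> []" "z \<noteq> []"
    show "x @ replicate (Suc t) M \<le> z @ y"
    proof (cases "length y \<le> length x")
      case True
      define z' where "z' = drop (length y) x"
      have x: "x = y @ z'" and z: "z = z' @ replicate (Suc t) M"
        using arg_cong[OF yz(1), of "take (length y)"] arg_cong[OF yz(1), of "drop (length y)"] True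
        by (auto simp: z'_def simp del: replicate_Suc) (metis append_take_drop_id)
      have "length z' < length x" using x yz(2) by simp
      then obtain u d r where u: "x = u @ d # r" "length u = length z'"
        by (metis id_take_nth_drop length_take min.absorb4)
      have "u @ (d # r @ c # replicate t M) \<le> z' @ (c # replicate t M @ y)"
        using necklaceD[of y "z' @ c # replicate t M"] neck u(1) x
        by (metis append.assoc append_Cons)
      then have "u < z' \<or> u = z' \<and> d \<le> c"
        by (auto simp: append_le_append_iff[OF u(2)])
      then have "u @ (d # r @ replicate (Suc t) M) \<le> z' @ (replicate (Suc t) M @ y)"
        unfolding append_le_append_iff[OF u(2)] using assms(2) by auto
      then show ?thesis using u(1) z by simp
    next
      case False
      have "z = drop (length y) (x @ replicate (Suc t) M)" unfolding yz(1) by simp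
      also have "\<dots> = replicate (Suc t - (length y - length x)) M" using False by (simp del: replicate_Suc)
      finally have "set z \<subseteq> {M}" by auto
      then obtain z'' where z: "z = M # z''" using yz(3) by (cases z) auto
      have "x @ c # replicate t M \<le> (c # replicate t M) @ x"
        by (rule necklaceD[OF neck])
      then have "a \<le> c" using Cons by auto
      then show ?thesis using Cons z assms(2) by simp
    qed
  qed
  then show ?thesis using assms by (auto simp: Neck_Suc_iff)
qed (use assms replicate_in_Neck[of n M] in \<open>auto simp: Neck_Suc_iff\<close>)

section \<open>Periodic reduction\<close>

lemma nth_concat_replicate:
  "i < q * length P \<Longrightarrow> concat (replicate q P) ! i = P ! (i mod length P)"
proof (induction q arbitrary: i)
  case (Suc q)
  show ?case
  proof (cases "i < length P")
    case False
    then show ?thesis using Suc by (simp add: nth_append le_mod_geq)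
  qed (simp add: nth_append)
qed simp

lemma pr_period:
  assumes "w \<noteq> []"
  shows "0 < length (pr w)" "length (pr w) dvd length w"
    "w = concat (replicate (length w div length (pr w)) (pr w))"
    "pr w = take (length (pr w)) w"
proof -
  let ?Q = "\<lambda>p. 0 < p \<and> p dvd length w \<and> w = concat (replicate (length w div p) (take p w))"
  define p where "p = (LEAST p. ?Q p)"
  have "?Q (length w)" using assms by simp
  then have Q: "?Q p" unfolding p_def by (rule LeastI)
  have pr: "pr w = take p w" by (simp add: pr_def p_def)
  have "length (pr w) = p" using Q assms by (simp add: pr dvd_imp_le)
  then show "0 < length (pr w)" "length (pr w) dvd length w"
    "w = concat (replicate (length w div length (pr w)) (pr w))"
    "pr w = take (length (pr w)) w" using Q pr by auto
qed

lemma length_pr_le_period: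
  assumes "0 < p" "p dvd length w" "w = concat (replicate (length w div p) (take p w))"
  shows "length (pr w) \<le> p"
  unfolding pr_def using Least_le[of "\<lambda>p. 0 < p \<and> p dvd length w \<and>
                  w = concat (replicate (length w div p) (take p w))" p] assms
  by auto

lemma nth_pr_mod:
  assumes "i < length w"
  shows "w ! i = pr w ! (i mod length (pr w))"
proof -
  have w: "w \<noteq> []" using assms by auto
  show ?thesis
    using nth_concat_replicate[of i "length w div length (pr w)" "pr w"] pr_period[OF w] assms
    by simp
qed

lemma nth_pr_mod_cyclic:
  assumes "w \<noteq> []"
  shows "w ! (i mod length w) = pr w ! (i mod length (pr w))"
  using nth_pr_mod[of "i mod length w" w] assms pr_period(2)[OF assms]
  by (simp add: mod_mod_cancel)

lemma pr_replicate:
  assumes "0 < n"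
  shows "pr (replicate n M) = [M]"
proof -
  have "concat (replicate n [M]) = replicate n M" by (induction n) auto
  then have "length (pr (replicate n M)) \<le> 1"
    using assms by (intro length_pr_le_period) auto
  then have "length (pr (replicate n M)) = 1"
    using pr_period(1)[of "replicate n M"] assms by (simp add: le_Suc_eq)
  then show ?thesis using pr_period(4)[of "replicate n M"] assms
    by (metis One_nat_def Suc_leI min.absorb1 replicate_0 replicate_Suc take_replicate
        length_greater_0_conv length_replicate)
qed

text \<open>If \<open>pr w\<close> had length at most \<open>t\<close>, moving one period to the
  right from \<open>c\<close> would land in the final run and force \<open>c = M\<close>. So the run
  fits into one copy of \<open>pr w\<close>, and the last copy in \<open>w\<close> shows that
  \<open>pr w\<close> ends with it.\<close>

lemma pr_tail:
  assumes w: "w = x @ c # replicate t M" and "c \<noteq> M"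
  shows "t < length (pr w)"
    and "i < length (pr w) \<Longrightarrow> length (pr w) \<le> i + t \<Longrightarrow> pr w ! i = M"
proof -
  let ?p = "length (pr w)"
  have w0: "w \<noteq> []" using w by simp
  have len: "length w = length x + 1 + t" using w by simp
  have tail: "w ! j = M" if "length x < j" "j < length w" for j
    using that by (auto simp: w nth_append nth_Cons split: nat.split)
  show "t < ?p"
  proof (rule ccontr)
    assume "\<not> t < ?p"
    then have "length x + ?p < length w" using len by simp
    then have "w ! (length x + ?p) = w ! length x"
      by (simp add: nth_pr_mod)
    then show False
      using tail[of "length x + ?p"] \<open>length x + ?p < length w\<close> pr_period(1)[OF w0] \<open>c \<noteq> M\<close>
      by (simp add: w)
  qed
  assume i: "i < ?p" "?p \<le> i + t"
  obtain q where q: "length w = ?p * q" using pr_period(2)[OF w0] by blast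
  then obtain q' where "q = Suc q'" using w0 by (cases q) auto
  then have q': "length w = ?p + ?p * q'" using q by simp
  \<comment> \<open>Position \<open>i\<close> in the last of the \<open>Suc q'\<close> copies of
    \<open>pr w\<close>.\<close>
  have "w ! (i + ?p * q') = pr w ! i"
    using nth_pr_mod[of "i + ?p * q'" w] i q' by simp
  moreover have "w ! (i + ?p * q') = M" using i q' len by (intro tail) auto
  ultimately show "pr w ! i = M" by simp
qed

section \<open>Windows and rotations\<close>

lemma length_cyclic_window [simp]: "length (cyclic_window n w i) = n"
  by (simp add: cyclic_window_def)

lemma nth_cyclic_window [simp]:
  "j < n \<Longrightarrow> cyclic_window n w i ! j = w ! ((i + j) mod length w)"
  by (simp add: cyclic_window_def)

lemma cyclic_window_length: "cyclic_window (length w) w i = rotate i w"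
  by (rule nth_equalityI) (simp_all add: nth_rotate)

text \<open>As \<open>w\<close> is a power of \<open>pr w\<close>, both unroll to the same infinite
  periodic word; a window longer than \<open>pr w\<close> wraps several times.\<close>

lemma cyclic_window_pr:
  "w \<noteq> [] \<Longrightarrow> cyclic_window n (pr w) i = cyclic_window n w i"
  by (rule nth_equalityI) (simp_all add: nth_pr_mod_cyclic)

text \<open>Lets starting positions be arbitrary natural numbers, so that covering a word only asks
  for some \<open>j\<close>.\<close>

lemma cyclic_window_mod: "cyclic_window n w (i mod length w) = cyclic_window n w i"
  by (rule nth_equalityI) (simp_all add: mod_add_left_eq)

lemma cyclic_window_in_sub: "w \<noteq> [] \<Longrightarrow> cyclic_window n w i \<in> sub n w"
  unfolding sub_def using cyclic_window_mod[of n w i, symmetric] by auto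

lemma sub_conv_rotate:
  assumes "length w = n" "0 < n"
  shows "sub n w = range (\<lambda>i. rotate i w)"
proof -
  have "w \<noteq> []" using assms by auto
  then show ?thesis
    using cyclic_window_in_sub[of w n] cyclic_window_length[of w] assms by (auto simp: sub_def)
qed

lemma rotate_eq_imp_rotate_diff:
  assumes "rotate i w = rotate j w" "i \<le> j"
  shows "rotate (j - i) w = w"
proof -
  have "rotate i (rotate (j - i) w) = rotate i w"
    using assms by (simp add: rotate_rotate)
  then show ?thesis by (metis inj_fn[OF inj_rotate1] injD rotate_def)
qed

text \<open>Let \<open>p\<close> be the least positive rotation that fixes \<open>w\<close>. The
  first \<open>p\<close> rotations are distinct, and \<open>w\<close> is a power of its prefix of
  length \<open>p\<close>, whence \<open>length (pr w) \<le> p\<close>. An inequality suffices,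
  since \<open>universal_cycleI\<close> forces equality of the totals.\<close>

lemma length_pr_le_card_sub:
  assumes "length w = n" "0 < n"
  shows "length (pr w) \<le> card (sub n w)"
proof -
  define p where "p = (LEAST d. 0 < d \<and> rotate d w = w)"
  have "0 < n \<and> rotate n w = w" using assms by simp
  then have p: "0 < p" "rotate p w = w"
    unfolding p_def by (metis (mono_tags, lifting) LeastI)+
  have min: "rotate d w \<noteq> w" if "0 < d" "d < p" for d
    using not_less_Least[of d "\<lambda>d. 0 < d \<and> rotate d w = w"] that by (auto simp: p_def)
  have mult: "rotate (p * q) w = w" for q
    by (induction q) (simp_all add: p(2) flip: rotate_rotate)
  \<comment> \<open>Rotation by the remainder also fixes \<open>w\<close>, so minimality of
    \<open>p\<close> makes the remainder zero.\<close>
  have "rotate (n mod p) w = rotate (n mod p) (rotate (p * (n div p)) w)" by (simp add: mult)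
  also have "\<dots> = w" using assms by (simp add: rotate_rotate)
  finally have "n mod p = 0" using min[of "n mod p"] p(1) by fastforce
  then have dvd: "p dvd n" by auto
  have "w = concat (replicate (length w div p) (take p w))"
  proof (rule nth_equalityI)
    have lt: "length (take p w) = p" using dvd assms by (simp add: dvd_imp_le)
    then show "length w = length (concat (replicate (length w div p) (take p w)))"
      using dvd assms by (simp add: length_concat sum_list_replicate)
    fix i assume i: "i < length w"
    have "i mod p < length w" using i mod_less_eq_dividend[of i p] by linarith
    \<comment> \<open>Rotating by the largest multiple of \<open>p\<close> up to \<open>i\<close>
      brings letter \<open>i\<close> to position \<open>i mod p\<close>.\<close>
    then have "w ! i = rotate (p * (i div p)) w ! (i mod p)"
      using i by (subst nth_rotate) auto
    also have "\<dots> = w ! (i mod p)" by (simp add: mult)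
    also have "\<dots> = concat (replicate (length w div p) (take p w)) ! i"
      using nth_concat_replicate[of i "length w div p" "take p w"] lt dvd assms i p(1) by simp
    finally show "w ! i = concat (replicate (length w div p) (take p w)) ! i" .
  qed
  then have "length (pr w) \<le> p" using length_pr_le_period p(1) dvd assms by blast
  also have "p = card ((\<lambda>i. rotate i w) ` {..<p})"
  proof (subst card_image)
    have False if "i < j" "j < p" "rotate i w = rotate j w" for i j
      using min[of "j - i"] rotate_eq_imp_rotate_diff[OF that(3)] that(1,2) by linarith
    then show "inj_on (\<lambda>i. rotate i w) {..<p}"
      by (metis inj_onI lessThan_iff linorder_neqE_nat)
  qed simp
  also have "\<dots> \<le> card (sub n w)"
  proof (rule card_mono)
    show "finite (sub n w)" by (simp add: sub_def)
  qed (auto simp: sub_conv_rotate[OF assms])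
  finally show ?thesis .
qed

text \<open>A common window is a rotation of both words, so each is a rotation of the other; being
  least among its rotations, each is at most the other.\<close>

lemma sub_necklaces_disjoint:
  assumes "v \<in> Neck k n" "w \<in> Neck k n" "0 < n" "sub n v \<inter> sub n w \<noteq> {}"
  shows "v = w"
proof -
  have len: "length v = n" "length w = n" and neck: "necklace v" "necklace w"
    using assms by (auto simp: Neck_def strings_def)
  have *: "b \<le> a" if "rotate i a = rotate j b" "necklace b" "length a = n" for i j and a b :: "nat list"
  proof -
    \<comment> \<open>Together with \<open>rotate i\<close> this makes \<open>i\<close> full turns,
      so \<open>a\<close> is itself a rotation of \<open>b\<close>.\<close>
    have "rotate (n * i - i) (rotate i a) = a"
      using that(3) assms(3) by (simp add: rotate_rotate rotate_conv_mod[of "n * i"])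
    then show ?thesis using that(1,2) by (metis necklace_def rotate_rotate)
  qed
  obtain i j where "rotate i v = rotate j w"
    using assms(4) len by (auto simp: sub_conv_rotate[OF _ assms(3)])
  then show ?thesis using *[of i v j w] *[of j w i v] len neck by simp
qed

section \<open>Final segments of the list of necklaces\<close>

text \<open>Upward closure replaces counting from the end of the list: it passes to tails, as the
  induction requires, and puts every necklace above a listed one into the list.\<close>

definition final_necklaces :: "nat \<Rightarrow> nat \<Rightarrow> nat list list \<Rightarrow> bool" where
  "final_necklaces M n ws \<longleftrightarrow> sorted_wrt (<) ws \<and> set ws \<subseteq> Neck (Suc M) n \<and>
     (\<forall>v\<in>set ws. \<forall>w\<in>Neck (Suc M) n. v \<le> w \<longrightarrow> w \<in> set ws)"

lemma final_necklaces_singleton: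
  assumes "final_necklaces M n [w]"
  shows "w = replicate n M"
  using assms replicate_in_Neck[of n M] le_replicate[of w M]
  by (auto simp: final_necklaces_def Neck_Suc_iff)

text \<open>The raised word \<open>x @ replicate (Suc t) M\<close> is a necklace above
  \<open>v\<close>, hence listed after \<open>v\<close>, so \<open>w\<close> is at most this word.
  Thus \<open>w\<close> lies between two words starting with \<open>x\<close> and starts with
  \<open>x\<close> too. Membership of the raised word is kept for the base case of the
  induction.\<close>

lemma final_necklaces_Cons_Cons:
  assumes "final_necklaces M n (v # w # ws)"
  obtains x c t where "final_necklaces M n (w # ws)" "v = x @ c # replicate t M" "c < M"
    "x @ replicate (Suc t) M \<in> set (w # ws)" "take (length x) w = x"
proof -
  have tl: "final_necklaces M n (w # ws)"
    unfolding final_necklaces_def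
  proof (intro conjI ballI impI)
    fix a b assume a: "a \<in> set (w # ws)" and b: "b \<in> Neck (Suc M) n" "a \<le> b"
    have "v < a" using a assms by (auto simp: final_necklaces_def)
    moreover have "b \<in> set (v # w # ws)"
      using a b assms unfolding final_necklaces_def by (meson list.set_intros(2))
    ultimately show "b \<in> set (w # ws)" using b(2) by auto
  qed (use assms in \<open>auto simp: final_necklaces_def\<close>)
  have v: "v \<in> Neck (Suc M) n" and w: "w \<in> Neck (Suc M) n" and "v < w"
    using assms by (auto simp: final_necklaces_def)
  have "length v = n" "w \<le> replicate n M"
    using v w le_replicate[of w M] by (auto simp: Neck_Suc_iff)
  \<comment> \<open>M^n is the greatest word, but \<open>w\<close> is above
    \<open>v\<close>.\<close>
  then have "v \<noteq> replicate (length v) M" using \<open>v < w\<close> by (metis leD)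
  from trailing_replicate_decomp[OF this]
  obtain x c t where v_eq: "v = x @ c # replicate t M" "c \<noteq> M" by blast
  then have "c < M" using v by (auto simp: Neck_Suc_iff)
  let ?g = "x @ replicate (Suc t) M"
  have "?g \<in> Neck (Suc M) n" using necklace_raise_tail v v_eq \<open>c < M\<close> by blast
  moreover have "v < ?g" unfolding v_eq(1) using \<open>c < M\<close> by (induction x) auto
  ultimately have g: "?g \<in> set (w # ws)"
    using assms unfolding final_necklaces_def
    by (metis less_imp_le list.set_intros(1) order_less_irrefl set_ConsD)
  then have "w \<le> ?g" using tl by (auto simp: final_necklaces_def)
  have "take (length x) w = x"
    using \<open>v < w\<close> \<open>w \<le> ?g\<close> v w v_eq(1)
    by (intro take_eq_between_common_prefix[of x "c # replicate t M" w "replicate (Suc t) M"])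
      (auto simp: Neck_Suc_iff)
  then show ?thesis using that tl v_eq(1) \<open>c < M\<close> g by blast
qed

section \<open>Joining two cycles\<close>

text \<open>The two greatest necklaces, c M^(n-1) and M^n, give the cycle c M^n. They are treated
  apart because \<open>pr\<close> of M^n has length 1, while \<open>join_cycles\<close> wants a
  cycle \<open>U\<close> of length at least \<open>n\<close>.\<close>

lemma join_base:
  assumes "2 \<le> n"
  shows "cyclic_window n (c # replicate n M) 1 = replicate n M"
    "i < n \<Longrightarrow> \<exists>j. cyclic_window n (c # replicate n M) j =
       cyclic_window n (c # replicate (n - 1) M) i"
proof -
  have nth: "(c # replicate l M) ! r = (if r = 0 then c else M)" if "r \<le> l" for r l
    using that by (cases r) auto
  show "cyclic_window n (c # replicate n M) 1 = replicate n M"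
    by (rule nth_equalityI) (simp_all del: replicate_Suc)
  assume i: "i < n"
  \<comment> \<open>The extra \<open>M\<close> lengthens the run before the next \<open>c\<close>;
    starting one place later keeps the distance to that \<open>c\<close>. The window starting at
    \<open>c\<close> itself stays.\<close>
  have "cyclic_window n (c # replicate n M) (if i = 0 then 0 else Suc i) =
    cyclic_window n (c # replicate (n - 1) M) i"
  proof (rule nth_equalityI)
    fix j assume "j < length (cyclic_window n (c # replicate n M) (if i = 0 then 0 else Suc i))"
    then have j: "j < n" by simp
    have "(i + j) mod n = (if i + j < n then i + j else i + j - n)"
      using i j by (simp add: le_mod_geq)
    moreover have "(Suc i + j) mod Suc n = (if i + j < n then Suc (i + j) else i + j - n)"
      using i j by (simp add: le_mod_geq)
    ultimately show "cyclic_window n (c # replicate n M) (if i = 0 then 0 else Suc i) ! j =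
      cyclic_window n (c # replicate (n - 1) M) i ! j"
      using i j by (auto simp: nth)
  qed simp
  then show "\<exists>j. cyclic_window n (c # replicate n M) j =
       cyclic_window n (c # replicate (n - 1) M) i" by blast
qed

text \<open>Both cycles end with M^t, and \<open>U\<close> starts like a continuation of
  \<open>A\<close> for n - 1 - t letters. A window starting before the final \<open>t\<close>
  letters of its cycle keeps its place, as it passes the end by at most n - 1 - t letters. Windows
  starting within these \<open>t\<close> letters change sides: those of \<open>U\<close> move to the
  end of \<open>A\<close>, those of \<open>A\<close> to the end of \<open>U\<close>.
  \<open>A\<close> may be shorter than \<open>n\<close>, hence the \<open>mod\<close> in
  \<open>agree\<close>.\<close>

lemma join_cycles:
  fixes A U :: "nat list"
  assumes tp: "t < length A" and tn: "t < n" and nl: "n \<le> length U"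
    and A_tail: "\<And>i. i < length A \<Longrightarrow> length A \<le> i + t \<Longrightarrow> A ! i = M"
    and U_tail: "\<And>i. i < length U \<Longrightarrow> length U \<le> i + t \<Longrightarrow> U ! i = M"
    and agree: "\<And>r. r + t + 1 < n \<Longrightarrow> U ! r = A ! (r mod length A)"
  shows "\<And>r. r < n \<Longrightarrow> (A @ U) ! r = A ! (r mod length A)"
    and "\<And>i. i < length U \<Longrightarrow> \<exists>j. cyclic_window n (A @ U) j = cyclic_window n U i"
    and "\<And>i. i < length A \<Longrightarrow> \<exists>j. cyclic_window n (A @ U) j = cyclic_window n A i"
proof -
  let ?p = "length A" and ?l = "length U"
  \<comment> \<open>For \<open>r\<close> beyond \<open>A\<close>, the bound
    \<open>t < length A\<close> brings \<open>r - ?p\<close> into the range of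
    \<open>agree\<close>.\<close>
  show start: "(A @ U) ! r = A ! (r mod ?p)" if "r < n" for r
    using agree[of "r - ?p"] that tp by (auto simp: nth_append le_mod_geq)
  fix i
  show "\<exists>j. cyclic_window n (A @ U) j = cyclic_window n U i" if i: "i < ?l"
  proof (cases "i + t < ?l")
    case True
    have "cyclic_window n (A @ U) (?p + i) = cyclic_window n U i"
    proof (rule nth_equalityI)
      fix j assume "j < length (cyclic_window n (A @ U) (?p + i))"
      then have j: "j < n" by simp
      show "cyclic_window n (A @ U) (?p + i) ! j = cyclic_window n U i ! j"
      proof (cases "i + j < ?l")
        case False
        define r where "r = i + j - ?l"
        have r: "r + t + 1 < n" "i + j = ?l + r" using False True j nl by (auto simp: r_def)
        have "(?p + i + j) mod (?p + ?l) = r" "(i + j) mod ?l = r"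
          using r nl by (simp_all add: add.assoc le_mod_geq)
        then show ?thesis using j r agree[of r] start[of r] by simp
      qed (use j in \<open>simp add: nth_append\<close>)
    qed simp
    then show ?thesis by blast
  next
    case False
    define s where "s = ?l - i"
    have s: "s \<le> t" "0 < s" "i = ?l - s" "s \<le> ?l" using False i by (auto simp: s_def)
    \<comment> \<open>The \<open>s\<close> letters \<open>M\<close> that end \<open>U\<close> also
      end \<open>A\<close>, and there too the start of \<open>U\<close> follows.\<close>
    have "cyclic_window n (A @ U) (?p - s) = cyclic_window n U i"
    proof (rule nth_equalityI)
      fix j assume "j < length (cyclic_window n (A @ U) (?p - s))"
      then have j: "j < n" by simp
      show "cyclic_window n (A @ U) (?p - s) ! j = cyclic_window n U i ! j"
      proof (cases "j < s")
        case True
        then have "?p - s + j < ?p" "i + j < ?l" using s tp by auto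
        then show ?thesis using j s tp A_tail[of "?p - s + j"] U_tail[of "i + j"]
          by (simp add: nth_append)
      next
        case False
        then have "?p - s + j = ?p + (j - s)" "i + j = ?l + (j - s)" "j - s < ?l"
          using s tp j nl by auto
        then show ?thesis using j by (simp add: nth_append)
      qed
    qed simp
    then show ?thesis by blast
  qed
  show "\<exists>j. cyclic_window n (A @ U) j = cyclic_window n A i" if i: "i < ?p"
  proof (cases "i + t < ?p")
    case True
    have "cyclic_window n (A @ U) i = cyclic_window n A i"
    proof (rule nth_equalityI)
      fix j assume "j < length (cyclic_window n (A @ U) i)"
      then have j: "j < n" by simp
      show "cyclic_window n (A @ U) i ! j = cyclic_window n A i ! j"
      proof (cases "i + j < ?p")
        case False
        then have "i + j < ?p + ?l" "i + j - ?p + t + 1 < n" using True i j nl by auto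
        then show ?thesis using j False agree[of "i + j - ?p"]
          by (simp add: nth_append le_mod_geq)
      qed (use j in \<open>simp add: nth_append\<close>)
    qed simp
    then show ?thesis by blast
  next
    case False
    define s where "s = ?p - i"
    have s: "s \<le> t" "0 < s" "i = ?p - s" "s \<le> ?p" using False i by (auto simp: s_def)
    have sl: "s < ?l" using s tn nl by simp
    \<comment> \<open>After the last \<open>s\<close> letters of \<open>U\<close> the joined cycle
      begins again, and by \<open>start\<close> it reads like \<open>A\<close>.\<close>
    have "cyclic_window n (A @ U) (?p + ?l - s) = cyclic_window n A i"
    proof (rule nth_equalityI)
      fix j assume "j < length (cyclic_window n (A @ U) (?p + ?l - s))"
      then have j: "j < n" by simp
      show "cyclic_window n (A @ U) (?p + ?l - s) ! j = cyclic_window n A i ! j"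
      proof (cases "j < s")
        case True
        have "(A @ U) ! (?p + ?l - s + j) = U ! (?l - s + j)"
        proof -
          have "?p + ?l - s + j = ?p + (?l - s + j)" using sl by simp
          then show ?thesis by (metis nth_append_length_plus)
        qed
        then show ?thesis using True j s sl U_tail[of "?l - s + j"] A_tail[of "i + j"] by simp
      next
        case False
        then have "?p + ?l - s + j = (?p + ?l) + (j - s)" "i + j = ?p + (j - s)" "j - s < ?p + ?l"
          using s sl j nl by auto
        then show ?thesis using j start[of "j - s"] by simp
      qed
    qed simp
    then show ?thesis by blast
  qed
qed

text \<open>The induction starts with two necklaces. Its extra claims feed
  \<open>join_cycles\<close> at the next step: the first \<open>n\<close> letters are the whole head
  necklace, which yields \<open>agree\<close>, and the last \<open>n\<close> letters are all
  \<open>M\<close>, which covers every \<open>t < n\<close>.\<close>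

lemma UC_final_necklaces:
  assumes "2 \<le> n" "final_necklaces M n ws" "2 \<le> length ws"
  shows "n \<le> length (UC ws) \<and> (\<forall>r<n. UC ws ! r = hd ws ! r) \<and>
    (\<forall>i<length (UC ws). length (UC ws) \<le> i + n \<longrightarrow> UC ws ! i = M) \<and>
    (\<forall>w\<in>set ws. \<forall>i. \<exists>j. cyclic_window n (UC ws) j = cyclic_window n w i)"
  using assms(2,3)
proof (induction ws)
  case (Cons v ws)
  then obtain w ws' where ws: "ws = w # ws'" by (cases ws) auto
  obtain x c t where tl: "final_necklaces M n ws" and v: "v = x @ c # replicate t M" "c < M"
    and g: "x @ replicate (Suc t) M \<in> set ws" and pre: "take (length x) w = x"
    using Cons.prems final_necklaces_Cons_Cons[of M n v w ws'] ws by metis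
  have vN: "v \<in> Neck (Suc M) n" using Cons.prems by (simp add: final_necklaces_def)
  then have lv: "length v = n" by (simp add: Neck_Suc_iff)
  have n: "n = length x + 1 + t" using v lv by simp
  have v0: "v \<noteq> []" using v by simp
  note pv = pr_period[OF v0] and tail = pr_tail[OF v(1) less_imp_neq[OF v(2)]]
  show ?case
  proof (cases ws')
    case Nil
    then have w: "w = replicate n M" using tl ws final_necklaces_singleton by simp
    \<comment> \<open>Otherwise the raised word, which must be M^n, makes \<open>v\<close> begin
      with \<open>M\<close>, and the rotation of \<open>v\<close> beginning with \<open>c\<close> is
      smaller.\<close>
    have "x = []"
    proof (cases x)
      case (Cons a x')
      have "a = M" using g ws Nil w n Cons by (simp add: replicate_add)
      moreover have "x @ c # replicate t M \<le> (c # replicate t M) @ x"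
        using vN v by (intro necklaceD) (simp add: Neck_Suc_iff)
      ultimately show ?thesis using Cons v(2) by simp
    qed simp
    then have v': "v = c # replicate (n - 1) M" using v n by simp
    \<comment> \<open>By \<open>pr_tail\<close> the length exceeds n - 1, and it divides
      \<open>n\<close>.\<close>
    have "length (pr v) = n"
      using tail(1) n \<open>x = []\<close> dvd_imp_le[OF pv(2)] lv assms(1) by simp
    then have "pr v = v" using pv(4) lv by simp
    then have "UC (v # ws) = v @ [M]"
      using ws Nil w assms(1) by (simp add: UC_def pr_replicate)
    also have "\<dots> = c # replicate n M"
      using v' assms(1) by (cases n) (simp_all add: replicate_append_same)
    finally have U: "UC (v # ws) = c # replicate n M" .
    have "\<exists>j. cyclic_window n (c # replicate n M) j = cyclic_window n v i" for i
      using join_base(2)[OF assms(1), of "i mod n" c M] v' assms(1) cyclic_window_mod[of n v i] lv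
      by auto
    moreover have "cyclic_window n w i = replicate n M" for i
      using assms(1) w by (intro nth_equalityI) auto
    ultimately have "\<forall>u\<in>set (v # ws). \<forall>i. \<exists>j. cyclic_window n (c # replicate n M) j = cyclic_window n u i"
      using join_base(1)[OF assms(1), of c M] ws Nil by auto
    moreover have "hd (v # ws) = c # replicate (n - 1) M" using v' by simp
    ultimately show ?thesis
      unfolding U by (auto simp: nth_Cons simp del: replicate_Suc split: nat.split)
  next
    case (Cons w' ws'')
    have IH: "n \<le> length (UC ws)" "\<forall>r<n. UC ws ! r = w ! r"
      "\<forall>i<length (UC ws). length (UC ws) \<le> i + n \<longrightarrow> UC ws ! i = M"
      "\<forall>w\<in>set ws. \<forall>i. \<exists>j. cyclic_window n (UC ws) j = cyclic_window n w i"
      using Cons.IH[OF tl] ws Cons by auto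
    have U: "UC (v # ws) = pr v @ UC ws" by (simp add: UC_def)
    \<comment> \<open>For r < n - 1 - t the letter lies in \<open>x\<close>, the common prefix of
      \<open>v\<close> and its successor \<open>w\<close>.\<close>
    have agree: "UC ws ! r = pr v ! (r mod length (pr v))" if "r + t + 1 < n" for r
    proof -
      have r: "r < length x" using that n by simp
      have "UC ws ! r = w ! r" using IH(2) that by simp
      also have "\<dots> = x ! r" using pre r by (metis nth_take)
      also have "\<dots> = v ! r" using v r by (simp add: nth_append)
      finally show ?thesis using nth_pr_mod[of r v] that lv by simp
    qed
    have U_tail: "UC ws ! i = M" if "i < length (UC ws)" "length (UC ws) \<le> i + t" for i
      using IH(3) that n by simp
    have tn: "t < n" using n by simp
    note join = join_cycles[OF tail(1) tn IH(1) tail(2) U_tail agree, simplified]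
    have U0: "UC ws \<noteq> []" using IH(1) assms(1) by auto
    have "\<exists>j. cyclic_window n (UC (v # ws)) j = cyclic_window n v i" for i
    proof -
      have "i mod length (pr v) < length (pr v)" using pv(1) by (rule mod_less_divisor)
      then obtain j where "cyclic_window n (UC (v # ws)) j = cyclic_window n (pr v) (i mod length (pr v))"
        using join(3) U by metis
      also have "\<dots> = cyclic_window n v i"
        unfolding cyclic_window_mod using v0 by (rule cyclic_window_pr)
      finally show ?thesis by blast
    qed
    moreover have "\<exists>j. cyclic_window n (UC (v # ws)) j = cyclic_window n u i" if "u \<in> set ws" for u i
    proof -
      from IH(4)[rule_format, OF that]
      obtain j where "cyclic_window n (UC ws) j = cyclic_window n u i" by (rule exE)
      moreover have "j mod length (UC ws) < length (UC ws)" using U0 by simp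
      then obtain j' where
        "cyclic_window n (UC (v # ws)) j' = cyclic_window n (UC ws) (j mod length (UC ws))"
        using join(2) U by metis
      ultimately show ?thesis unfolding cyclic_window_mod by metis
    qed
    moreover have "UC (v # ws) ! r = v ! r" if "r < n" for r
      using join(1)[OF that] nth_pr_mod[of r v] that lv U by metis
    moreover have "UC (v # ws) ! i = M"
      if "i < length (UC (v # ws))" "length (UC (v # ws)) \<le> i + n" for i
      using that IH(1,3) by (simp add: U nth_append)
    moreover have "n \<le> length (UC (v # ws))" using IH(1) U by simp
    ultimately show ?thesis by auto
  qed
qed simp

section \<open>Counting: from covering every word to covering it exactly once\<close>

lemma length_UC_le_card:
  assumes "0 < n" "distinct ws" "set ws \<subseteq> Neck k n"
  shows "length (UC ws) \<le> card (\<Union>w\<in>set ws. sub n w)"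
proof -
  have "length (UC ws) = (\<Sum>w\<in>set ws. length (pr w))"
    using assms(2) by (simp add: UC_def length_concat comp_def sum_list_distinct_conv_sum_set)
  also have "\<dots> \<le> (\<Sum>w\<in>set ws. card (sub n w))"
    using assms by (intro sum_mono length_pr_le_card_sub) (auto simp: Neck_def strings_def)
  also have "\<dots> = card (\<Union>w\<in>set ws. sub n w)"
  proof (rule card_UN_disjoint[symmetric])
    show "\<forall>w\<in>set ws. finite (sub n w)" by (simp add: sub_def)
    show "\<forall>v\<in>set ws. \<forall>w\<in>set ws. v \<noteq> w \<longrightarrow> sub n v \<inter> sub n w = {}"
      using assms sub_necklaces_disjoint by blast
  qed simp
  finally show ?thesis .
qed

text \<open>Pigeonhole: the windows at the \<open>length u\<close> positions cover \<open>S\<close>,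
  so \<open>card S\<close> is at most the number of distinct windows, which is at most
  \<open>length u\<close>, hence at most \<open>card S\<close>. Equality makes the window map
  injective on positions.\<close>

lemma universal_cycleI:
  assumes "S \<noteq> {}" "S \<subseteq> strings k n" "length u \<le> card S"
    and cover: "\<And>s. s \<in> S \<Longrightarrow> \<exists>i. cyclic_window n u i = s"
    and "u \<noteq> []"
  shows "universal_cycle k n S u"
proof -
  let ?f = "cyclic_window n u" and ?I = "{..<length u}"
  have "S \<subseteq> ?f ` ?I"
  proof
    fix s assume "s \<in> S"
    then obtain i where "?f i = s" using cover by blast
    then have "s = ?f (i mod length u)" by (simp add: cyclic_window_mod)
    then show "s \<in> ?f ` ?I" using \<open>u \<noteq> []\<close> by simp
  qed
  then have "card S \<le> card (?f ` ?I)" by (intro card_mono) auto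
  moreover have "card (?f ` ?I) \<le> length u" using card_image_le[of ?I ?f] by simp
  ultimately have len: "length u = card S" and "card (?f ` ?I) = card ?I"
    using assms(3) by auto
  then have inj: "inj_on ?f ?I" by (intro eq_card_imp_inj_on) auto
  have "\<exists>!i. i < length u \<and> ?f i = s" if "s \<in> S" for s
    using \<open>S \<subseteq> ?f ` ?I\<close> that inj by (auto simp: inj_on_def)
  then show ?thesis using assms(1,2) len by (simp add: universal_cycle_def)
qed

lemma final_necklaces_drop:
  "final_necklaces M n (drop d (sorted_list_of_set (Neck (Suc M) n)))"
proof -
  let ?L = "sorted_list_of_set (Neck (Suc M) n)"
  have L: "sorted_wrt (<) ?L" "set ?L = Neck (Suc M) n"
    using finite_Neck by auto
  have split: "?L = take d ?L @ drop d ?L" by simp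
  have lt: "a < b" if "a \<in> set (take d ?L)" "b \<in> set (drop d ?L)" for a b
    using L(1) that split by (metis sorted_wrt_append)
  have "w \<in> set (drop d ?L)" if "v \<in> set (drop d ?L)" "w \<in> Neck (Suc M) n" "v \<le> w" for v w
  proof (rule ccontr)
    assume "w \<notin> set (drop d ?L)"
    then have "w \<in> set (take d ?L)"
      using that(2) L(2) split by (metis Un_iff set_append)
    then show False using lt that by (meson leD)
  qed
  then show ?thesis
    using L sorted_wrt_drop[OF L(1)] set_drop_subset[of d ?L] by (auto simp: final_necklaces_def)
qed

theorem theorem2:
  fixes k n m :: nat and \<alpha>s :: "nat list list"
  assumes "k \<ge> 2" and "n \<ge> 2" and "2 \<le> m" and "m \<le> card (Neck k n)"
    and "\<alpha>s = drop (card (Neck k n) - m) (sorted_list_of_set (Neck k n))"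
  shows "universal_cycle k n (\<Union>\<alpha>\<in>set \<alpha>s. sub n \<alpha>) (UC \<alpha>s)"
proof -
  obtain M where k: "k = Suc M" using assms(1) by (cases k) auto
  have fin: "final_necklaces M n \<alpha>s"
    unfolding assms(5) k by (rule final_necklaces_drop)
  have len: "length \<alpha>s = m" using assms(4,5) by simp
  have neck: "set \<alpha>s \<subseteq> Neck k n" and "distinct \<alpha>s"
    using fin by (auto simp: final_necklaces_def k strict_sorted_iff)
  note UC = UC_final_necklaces[OF assms(2) fin]
  show ?thesis
  proof (rule universal_cycleI)
    obtain \<alpha> where \<alpha>: "\<alpha> \<in> set \<alpha>s" using len assms(3) by (cases \<alpha>s) auto
    then have "length \<alpha> = n" using neck by (auto simp: Neck_def strings_def)
    then have "\<alpha> \<noteq> []" using assms(2) by auto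
    then show "(\<Union>\<alpha>\<in>set \<alpha>s. sub n \<alpha>) \<noteq> {}" using \<alpha> cyclic_window_in_sub by blast
    show "(\<Union>\<alpha>\<in>set \<alpha>s. sub n \<alpha>) \<subseteq> strings k n"
    proof
      fix s assume "s \<in> (\<Union>\<alpha>\<in>set \<alpha>s. sub n \<alpha>)"
      then obtain \<alpha> where "\<alpha> \<in> Neck k n" "s \<in> sub n \<alpha>" using neck by auto
      then show "s \<in> strings k n"
        \<comment> \<open>Windows of length \<open>n\<close> are rotations here, so no new letters
          arise.\<close>
        using sub_conv_rotate[of \<alpha> n] assms(2) by (auto simp: Neck_def strings_def)
    qed
    show "length (UC \<alpha>s) \<le> card (\<Union>\<alpha>\<in>set \<alpha>s. sub n \<alpha>)"
      using length_UC_le_card neck \<open>distinct \<alpha>s\<close> assms(2) by simp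
    show "\<exists>i. cyclic_window n (UC \<alpha>s) i = s" if "s \<in> (\<Union>\<alpha>\<in>set \<alpha>s. sub n \<alpha>)" for s
      using UC len assms(3) that by (auto simp: sub_def)
    show "UC \<alpha>s \<noteq> []" using UC len assms(2,3) by auto
  qed
qed

end
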